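(* Let $p\ge 1$ be an integer, let $f:[0,+\infty)\to(-\infty,+\infty]$ be a strictly decreasing function and let $K(x,y):=f(|x-y|)$ for $x,y\in\mathbb R^p$. If $A\subset\mathbb R^p$ is a nonempty compact set and $N\in\mathbb N$, then any configuration $\omega_N^*=\{x_1,\ldots,x_N\}\subset\mathbb R^p$ such that $P_K(A,\omega_N^* )=\mathcal P_K^*(A,N)<+\infty$ has the property that $x_i\in\operatorname{conv}(A)$ for each $1\le i\le N$. In particular, if $A$ is convex and $\mathcal P_K^*(A,N)<+\infty$, then $\omega_N^*\subset A$ and $\mathcal P_K(A,N)=\mathcal P_K^*(A,N)$.
   Context: Configurations $\omega_N=\{x_1,\ldots,x_N\}$ are $N$-point multisets (lists in which points may be repeated). For a kernel $K:\mathbb R^p\times\mathbb R^p\to(-\infty,+\infty]$ and nonempty $A\subset\mathbb R^p$ set $$P_K(A,\omega_N):=\inf_{y\in A}\sum_{i=1}^N K(x_i,y),\qquad \mathcal P_K(A,N):=\sup_{\omega_N\subset A}P_K(A,\omega_N),\qquad \mathcal P_K^*(A,N):=\sup_{\omega_N\subset\mathbb R^p}P_K(A,\omega_N),$$ where the suprema are over $N$-point multisets. $\operatorname{conv}(A)$ denotes the convex hull of $A$. In the "in particular" part, $\omega_N^*$ again denotes a configuration with $P_K(A,\omega_N^* )=\mathcal P_K^*(A,N)$. *)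

theory Defs
  imports "HOL-Analysis.Analysis" "HOL-Library.Multiset"
begin

text \<open>
  Configurations are finite multisets; kernels take values in \<open>(-\<infinity>, \<infinity>]\<close>, modelled as \<^typ>\<open>ereal\<close>.
  The exclusion of \<open>-\<infinity>\<close> has to be assumed where these notions are used, so that the
  library convention \<open>\<infinity> + (-\<infinity>) = \<infinity>\<close> plays no role.
\<close>

definition polarization :: "('a \<Rightarrow> 'a \<Rightarrow> ereal) \<Rightarrow> 'a set \<Rightarrow> 'a multiset \<Rightarrow> ereal" where
  "polarization K A \<omega> = (INF y\<in>A. \<Sum>x\<in>#\<omega>. K x y)"

definition polarization_const :: "('a \<Rightarrow> 'a \<Rightarrow> ereal) \<Rightarrow> 'a set \<Rightarrow> nat \<Rightarrow> ereal" where
  "polarization_const K A N =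
     (SUP \<omega>\<in>{\<omega>. size \<omega> = N \<and> set_mset \<omega> \<subseteq> A}. polarization K A \<omega>)"

definition polarization_const_unrestricted :: "('a \<Rightarrow> 'a \<Rightarrow> ereal) \<Rightarrow> 'a set \<Rightarrow> nat \<Rightarrow> ereal" where
  "polarization_const_unrestricted K A N = (SUP \<omega>\<in>{\<omega>. size \<omega> = N}. polarization K A \<omega>)"

end

theory Submission
  imports Defs
begin

text \<open>
  If a point \<open>x\<close> of the configuration lies outside \<open>convex hull A\<close>, replace it by its nearest point
  \<open>p\<close> there. By compactness the distance to every point of \<open>A\<close> drops by at least some \<open>\<delta> > 0\<close>.
  No continuity of \<open>f\<close> is available, so the infimum over \<open>A\<close> need not be attained and a pointwise
  strict increase of the potential does not suffice; but a strictly decreasing \<open>f\<close> gains a uniform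
  \<open>\<epsilon> > 0\<close> over all steps of length at least \<open>\<delta>\<close> in a bounded range. Hence the polarization, which is
  finite, increases by \<open>\<epsilon>\<close>, contradicting maximality. When \<open>A\<close> is convex, projecting all
  points of a configuration onto \<open>A\<close> does not decrease its polarization, so the two constants agree.
\<close>

lemma strict_antimono_on_less:
  fixes f :: "real \<Rightarrow> 'b::order"
  assumes "strict_antimono_on {0..} f" "0 \<le> s" "s < t"
  shows "f t < f s"
  using assms by (auto simp: monotone_on_def)

lemma strict_antimono_on_le:
  fixes f :: "real \<Rightarrow> 'b::order"
  assumes "strict_antimono_on {0..} f" "0 \<le> s" "s \<le> t"
  shows "f t \<le> f s"
  using strict_antimono_on_less[OF assms(1,2), of t] assms(3) by (cases "s = t") auto

text \<open>Only at 0 can the value \<open>\<infinity>\<close> occur: at \<open>t > 0\<close> the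
  value lies strictly below \<open>f 0\<close>.\<close>

lemma strict_antimono_on_finite:
  fixes f :: "real \<Rightarrow> ereal"
  assumes "strict_antimono_on {0..} f" "\<And>t. 0 \<le> t \<Longrightarrow> - \<infinity> < f t" "0 < t"
  shows "\<bar>f t\<bar> \<noteq> \<infinity>"
  using strict_antimono_on_less[OF assms(1), of 0 t] assms(2)[of t] assms(3)
  by (cases "f t") auto

text \<open>On a grid of mesh \<open>\<delta> / 2\<close>, every step of length at least
  \<open>\<delta>\<close> spans a whole cell. Starting points up to \<open>R\<close> involve only
  finitely many cells, so the least drop of \<open>f\<close> over these is a common positive
  gain.\<close>

lemma strict_antimono_on_uniform_gap:
  fixes f :: "real \<Rightarrow> ereal"
  assumes anti: "strict_antimono_on {0..} f"
    and range: "\<And>t. 0 \<le> t \<Longrightarrow> - \<infinity> < f t"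
    and "0 < \<delta>"
  obtains \<epsilon> :: real where "0 < \<epsilon>"
    and "\<And>s t. 0 \<le> t \<Longrightarrow> t \<le> R \<Longrightarrow> t + \<delta> \<le> s \<Longrightarrow> f s + ereal \<epsilon> \<le> f t"
proof -
  define \<eta> where "\<eta> = \<delta> / 2"
  have \<eta>: "0 < \<eta>" using \<open>0 < \<delta>\<close> by (simp add: \<eta>_def)
  \<comment> \<open>Drop of \<open>f\<close> over the cell from \<open>(k + 1) * \<eta>\<close> to
    \<open>(k + 2) * \<eta>\<close>. The cell at 0 is left out because \<open>f 0\<close> may be
    infinite; both values used are finite, so \<open>real_of_ereal\<close> loses nothing.\<close>
  define gap where
    "gap k = real_of_ereal (f (real (k + 1) * \<eta>)) - real_of_ereal (f (real (k + 2) * \<eta>))" for k :: nat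
  define m where "m = nat \<lfloor>R / \<eta>\<rfloor>"
  define \<epsilon> where "\<epsilon> = Min (gap ` {..m})"
  have gap: "f (real (k + 2) * \<eta>) + ereal (gap k) = f (real (k + 1) * \<eta>) \<and> 0 < gap k" for k
  proof -
    have "f (real (k + 2) * \<eta>) < f (real (k + 1) * \<eta>)"
      using \<eta> by (intro strict_antimono_on_less[OF anti]) auto
    moreover have "\<bar>f (real (k + 1) * \<eta>)\<bar> \<noteq> \<infinity>" "\<bar>f (real (k + 2) * \<eta>)\<bar> \<noteq> \<infinity>"
      using \<eta> by (intro strict_antimono_on_finite[OF anti range]; simp)+
    ultimately show ?thesis
      unfolding gap_def
      by (cases "f (real (k + 1) * \<eta>)"; cases "f (real (k + 2) * \<eta>)") auto
  qed
  show thesis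
  proof (rule that)
    show "0 < \<epsilon>" unfolding \<epsilon>_def using gap by auto
    fix s t assume t: "0 \<le> t" "t \<le> R" and s: "t + \<delta> \<le> s"
    \<comment> \<open>Here \<open>k * \<eta> \<le> t \<le> (k + 1) * \<eta>\<close>, and
      \<open>\<delta> = 2 * \<eta>\<close> gives \<open>(k + 2) * \<eta> \<le> s\<close>. So the
      step from \<open>t\<close> to \<open>s\<close> covers the cell of
      \<open>gap k\<close>.\<close>
    define k where "k = nat \<lfloor>t / \<eta>\<rfloor>"
    have k_real: "real k = of_int \<lfloor>t / \<eta>\<rfloor>" using t \<eta> by (simp add: k_def)
    have "k \<le> m"
      unfolding k_def m_def using t \<eta> by (intro nat_mono floor_mono divide_right_mono) auto
    then have "\<epsilon> \<le> gap k" unfolding \<epsilon>_def by simp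
    have "real k \<le> t / \<eta>" "t / \<eta> \<le> real k + 1" unfolding k_real by linarith+
    then have "real k * \<eta> \<le> t" "t \<le> real (k + 1) * \<eta>" using \<eta> by (simp_all add: field_simps)
    moreover from this(1) s have "real (k + 2) * \<eta> \<le> s" by (simp add: \<eta>_def field_simps)
    ultimately have "f s \<le> f (real (k + 2) * \<eta>)" "f (real (k + 1) * \<eta>) \<le> f t"
      using t \<eta> by (auto intro!: strict_antimono_on_le[OF anti])
    then show "f s + ereal \<epsilon> \<le> f t"
      using gap[of k] \<open>\<epsilon> \<le> gap k\<close>
      by (metis add_mono ereal_less_eq(3) order_trans)
  qed
qed

text \<open>The projection \<open>p\<close> sees \<open>x\<close> and \<open>y\<close> at an angle
  of at least 90 degrees, so the square of \<open>dist x y\<close> exceeds that of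
  \<open>dist p y\<close> by at least that of \<open>dist x p\<close>, which is positive.\<close>

lemma closest_point_dist_less:
  fixes C :: "'a::euclidean_space set"
  assumes "convex C" "closed C" "y \<in> C" "x \<notin> C"
  shows "dist (closest_point C x) y < dist x y"
proof -
  define p where "p = closest_point C x"
  have "p \<noteq> x" using closest_point_in_set[of C x] assms unfolding p_def by force
  then have "0 < (x - p) \<bullet> (x - p)" by simp
  moreover have "(x - p) \<bullet> (y - p) \<le> 0"
    unfolding p_def using assms by (intro closest_point_dot)
  ultimately have "(p - y) \<bullet> (p - y) < (x - y) \<bullet> (x - y)"
    by (simp add: inner_diff_left inner_diff_right inner_commute)
  then show ?thesis by (simp add: p_def dist_norm norm_lt)
qed

lemma closest_point_dist_le:
  fixes C :: "'a::euclidean_space set"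
  assumes "convex C" "closed C" "y \<in> C"
  shows "dist (closest_point C x) y \<le> dist x y"
  using closest_point_dist_less[OF assms, of x] closest_point_self[of x C] by (cases "x \<in> C") auto

text \<open>The decrease in distance is continuous in \<open>y\<close> and positive on
  \<open>C\<close>, so its minimum over the compact set serves as \<open>\<delta>\<close>.\<close>

lemma closest_point_uniform_gap:
  fixes C :: "'a::euclidean_space set"
  assumes "convex C" "compact C" "C \<noteq> {}" "x \<notin> C"
  obtains \<delta> where "0 < \<delta>" and "\<And>y. y \<in> C \<Longrightarrow> dist (closest_point C x) y + \<delta> \<le> dist x y"
proof -
  have "continuous_on C (\<lambda>y. dist x y - dist (closest_point C x) y)"
    by (intro continuous_intros)
  then obtain z where z: "z \<in> C"
    and z_min: "\<And>y. y \<in> C \<Longrightarrow>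
      dist x z - dist (closest_point C x) z \<le> dist x y - dist (closest_point C x) y"
    using continuous_attains_inf[OF \<open>compact C\<close> \<open>C \<noteq> {}\<close>] by blast
  have "dist (closest_point C x) z < dist x z"
    using assms z by (intro closest_point_dist_less) (auto simp: compact_imp_closed)
  then show thesis
    using that[of "dist x z - dist (closest_point C x) z"] z_min by force
qed

text \<open>Used with a positive \<open>c\<close> for the contradiction to maximality and with
  \<open>c = 0\<close> for projecting a whole configuration.\<close>

lemma polarization_mono:
  assumes "\<And>y. y \<in> A \<Longrightarrow> (\<Sum>x\<in>#\<omega>. K x y) + c \<le> (\<Sum>x\<in>#\<omega>'. K x y)"
  shows "polarization K A \<omega> + c \<le> polarization K A \<omega>'"
  unfolding polarization_def
  by (intro INF_greatest order_trans[OF add_right_mono assms] INF_lower) auto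

lemma polarization_le_unrestricted:
  "polarization K A \<omega> \<le> polarization_const_unrestricted K A (size \<omega>)"
  unfolding polarization_const_unrestricted_def by (intro SUP_upper) simp

lemma polarization_const_le_unrestricted:
  "polarization_const K A N \<le> polarization_const_unrestricted K A N"
  unfolding polarization_const_def polarization_const_unrestricted_def
  by (intro SUP_subset_mono) auto

text \<open>Over a bounded set each summand is bounded below by some \<open>f R\<close>, although
  \<open>f\<close> itself may be unbounded below. This makes adding \<open>\<epsilon>\<close> to a
  polarization below \<open>\<infinity>\<close> a strict increase.\<close>

lemma polarization_radial_gt_MInf:
  fixes f :: "real \<Rightarrow> ereal" and A :: "'a::metric_space set"
  assumes anti: "strict_antimono_on {0..} f"
    and range: "\<And>t. 0 \<le> t \<Longrightarrow> - \<infinity> < f t"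
    and "bounded A"
  shows "- \<infinity> < polarization (\<lambda>x y. f (dist x y)) A \<omega>"
proof -
  have "\<exists>b::real. \<forall>y\<in>A. ereal b \<le> (\<Sum>x\<in>#\<omega>. f (dist x y))"
  proof (induction \<omega>)
    case empty
    then show ?case by (auto simp: zero_ereal_def)
  next
    case (add x \<omega>)
    then obtain b where b: "\<And>y. y \<in> A \<Longrightarrow> ereal b \<le> (\<Sum>x\<in>#\<omega>. f (dist x y))" by blast
    \<comment> \<open>\<open>R\<close> is taken positive so that \<open>f R\<close> is a real
      number.\<close>
    obtain R where R: "0 < R" "\<And>y. y \<in> A \<Longrightarrow> dist x y \<le> R"
      using bounded_any_center[of A x] \<open>bounded A\<close>
      by (meson linorder_not_less max.cobounded1 max.coboundedI2 order_trans zero_less_one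
          less_le_trans)
    obtain r where r: "f R = ereal r"
      using strict_antimono_on_finite[OF anti range R(1)] by (cases "f R") auto
    have "ereal (r + b) \<le> (\<Sum>x\<in>#add_mset x \<omega>. f (dist x y))" if "y \<in> A" for y
      using add_mono[OF strict_antimono_on_le[OF anti zero_le_dist R(2)] b, OF that that] r by simp
    then show ?case by blast
  qed
  then obtain b :: real where "\<forall>y\<in>A. ereal b \<le> (\<Sum>x\<in>#\<omega>. f (dist x y))" by blast
  then have "ereal b \<le> polarization (\<lambda>x y. f (dist x y)) A \<omega>"
    unfolding polarization_def by (intro INF_greatest) auto
  then show ?thesis by (rule less_le_trans[rotated]) simp
qed

lemma maximal_polarization_in_convex_hull:
  fixes f :: "real \<Rightarrow> ereal" and A :: "'a::euclidean_space set"
  defines "K \<equiv> \<lambda>x y. f (dist x y)"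
  assumes anti: "strict_antimono_on {0..} f"
    and range: "\<And>t. 0 \<le> t \<Longrightarrow> - \<infinity> < f t"
    and A: "A \<noteq> {}" "compact A"
    and max: "polarization K A \<omega> = polarization_const_unrestricted K A (size \<omega>)"
    and fin: "polarization K A \<omega> < \<infinity>"
    and x: "x \<in># \<omega>"
  shows "x \<in> convex hull A"
proof (rule ccontr)
  assume x_notin: "x \<notin> convex hull A"
  define p where "p = closest_point (convex hull A) x"
  obtain \<delta> where \<delta>: "0 < \<delta>" "\<And>y. y \<in> convex hull A \<Longrightarrow> dist p y + \<delta> \<le> dist x y"
    using closest_point_uniform_gap[of "convex hull A" x] A x_notin
    unfolding p_def by (auto simp: compact_convex_hull)
  obtain R where R: "\<And>y. y \<in> A \<Longrightarrow> dist p y \<le> R"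
    using bounded_any_center[of A p] compact_imp_bounded[OF A(2)] by blast
  obtain \<epsilon> where \<epsilon>: "0 < \<epsilon>"
    "\<And>s t. 0 \<le> t \<Longrightarrow> t \<le> R \<Longrightarrow> t + \<delta> \<le> s \<Longrightarrow> f s + ereal \<epsilon> \<le> f t"
    using strict_antimono_on_uniform_gap[OF anti range \<delta>(1)] by metis
  obtain \<omega>' where \<omega>: "\<omega> = add_mset x \<omega>'" using x by (meson mset_add)
  have "polarization K A \<omega> + ereal \<epsilon> \<le> polarization K A (add_mset p \<omega>')"
  proof (rule polarization_mono)
    fix y assume y: "y \<in> A"
    have "K x y + ereal \<epsilon> \<le> K p y"
      unfolding K_def using y R \<delta>(2) hull_subset[of A convex] by (intro \<epsilon>(2)) auto
    from add_right_mono[OF this, of "\<Sum>x\<in>#\<omega>'. K x y"]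
    show "(\<Sum>x\<in>#\<omega>. K x y) + ereal \<epsilon> \<le> (\<Sum>x\<in>#add_mset p \<omega>'. K x y)"
      by (simp add: \<omega> ac_simps)
  qed
  \<comment> \<open>The modified configuration has as many points as \<open>\<omega>\<close>, so it
    competes in the same supremum.\<close>
  also have "\<dots> \<le> polarization K A \<omega>"
    using polarization_le_unrestricted[of K A "add_mset p \<omega>'"] max by (simp add: \<omega>)
  \<comment> \<open>The inequality \<open>v + \<epsilon> \<le> v\<close> is absurd only for finite
    \<open>v\<close>, hence the bounds on both sides.\<close>
  finally show False
    using fin \<epsilon>(1) polarization_radial_gt_MInf[OF anti range compact_imp_bounded[OF A(2)], of \<omega>]
    unfolding K_def by (cases "polarization (\<lambda>x y. f (dist x y)) A \<omega>") auto
qed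

lemma polarization_const_convex:
  fixes f :: "real \<Rightarrow> ereal" and A :: "'a::euclidean_space set"
  defines "K \<equiv> \<lambda>x y. f (dist x y)"
  assumes anti: "strict_antimono_on {0..} f"
    and A: "A \<noteq> {}" "closed A" "convex A"
  shows "polarization_const K A N = polarization_const_unrestricted K A N"
proof (rule antisym[OF polarization_const_le_unrestricted])
  have "polarization K A \<omega> \<le> polarization_const K A (size \<omega>)" for \<omega>
  proof -
    define \<omega>' where "\<omega>' = image_mset (closest_point A) \<omega>"
    have "polarization K A \<omega> + 0 \<le> polarization K A \<omega>'"
    proof (rule polarization_mono)
      fix y assume y: "y \<in> A"
      have "K x y \<le> K (closest_point A x) y" for x
        unfolding K_def
        by (intro strict_antimono_on_le[OF anti] closest_point_dist_le A y zero_le_dist)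
      then show "(\<Sum>x\<in>#\<omega>. K x y) + 0 \<le> (\<Sum>x\<in>#\<omega>'. K x y)"
        by (simp add: \<omega>'_def image_mset.compositionality comp_def sum_mset_mono)
    qed
    \<comment> \<open>The projected points lie in \<open>A\<close> and their number is unchanged, so
      \<open>\<omega>'\<close> is admissible for the restricted supremum.\<close>
    also have "\<dots> \<le> polarization_const K A (size \<omega>)"
      unfolding polarization_const_def
      using closest_point_in_set[OF A(2,1)] by (intro SUP_upper) (auto simp: \<omega>'_def)
    finally show ?thesis by simp
  qed
  then show "polarization_const_unrestricted K A N \<le> polarization_const K A N"
    unfolding polarization_const_unrestricted_def by (intro SUP_least) auto
qed

theorem proposition1p7:
  fixes f :: "real \<Rightarrow> ereal"
    and K :: "real ^ 'p \<Rightarrow> real ^ 'p \<Rightarrow> ereal"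
    and A :: "(real ^ 'p) set"
    and N :: nat
  assumes f_range: "\<And>t. 0 \<le> t \<Longrightarrow> - \<infinity> < f t"
    and f_decreasing: "strict_antimono_on {0..} f"
    and K_radial: "\<And>x y. K x y = f (norm (x - y))"
    and A_nonempty: "A \<noteq> {}"
    and A_compact: "compact A"
  shows "(\<forall>\<omega>. size \<omega> = N \<and> polarization K A \<omega> = polarization_const_unrestricted K A N
             \<and> polarization_const_unrestricted K A N < \<infinity>
           \<longrightarrow> (\<forall>x\<in>#\<omega>. x \<in> convex hull A))
       \<and> (convex A \<and> polarization_const_unrestricted K A N < \<infinity> \<longrightarrow>
           (\<forall>\<omega>. size \<omega> = N \<and> polarization K A \<omega> = polarization_const_unrestricted K A N
              \<longrightarrow> set_mset \<omega> \<subseteq> A)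
           \<and> polarization_const K A N = polarization_const_unrestricted K A N)"
proof -
  have K: "K = (\<lambda>x y. f (dist x y))" by (intro ext) (simp add: K_radial dist_norm)
  have hull: "x \<in> convex hull A"
    if "size \<omega> = N" "polarization K A \<omega> = polarization_const_unrestricted K A N"
      "polarization_const_unrestricted K A N < \<infinity>" "x \<in># \<omega>" for \<omega> x
    using maximal_polarization_in_convex_hull[OF f_decreasing f_range A_nonempty A_compact] that
    unfolding K by auto
  moreover have "polarization_const K A N = polarization_const_unrestricted K A N" if "convex A"
    using polarization_const_convex[OF f_decreasing A_nonempty compact_imp_closed[OF A_compact] that]
    unfolding K .
  ultimately show ?thesis by (auto simp: convex_hull_eq[THEN iffD2])
qed

end
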